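(* Let $(V,\Delta,\lhd)$ be a shelf in a symmetric category $(\mathcal{C},\otimes,\mathbf{I},c)$. Then $$\sigma_{V,\Delta,\lhd}:=\lhd_2\circ c_1\circ\Delta_2: V\otimes V\to V\otimes V$$ is a weak braiding on $V$. If $V$ is moreover a rack in $\mathcal{C}$ (with additional structure $\varepsilon,\widetilde{\lhd}$), then $\sigma_{V,\Delta,\lhd}$ is a specific braiding, with inverse $$\sigma_{V,\Delta,\lhd}^{-1}=\widetilde{\lhd}_1\circ c_2\circ c_1\circ c_2\circ\Delta_1 .$$
   Context: All monoidal categories are strict; a symmetric category is a strict symmetric monoidal category $(\mathcal{C},\otimes,\mathbf{I},c)$. For a morphism $\varphi:V^{\otimes l}\to V^{\otimes r}$, $\varphi_i:=\operatorname{Id}_V^{\otimes(i-1)}\otimes\varphi\otimes\operatorname{Id}_V^{\otimes(k-i+1)}:V^{\otimes(k+l)}\to V^{\otimes(k+r)}$ (with $k$ clear from context), and $\varphi^n:=\varphi_1\circ\cdots\circ\varphi_1$ ($n$ times). We write $c$ for $c_{V,V}$. A weak braiding on $V$ is a morphism $\sigma:V\otimes V\to V\otimes V$ with $\sigma_1\sigma_2\sigma_1=\sigma_2\sigma_1\sigma_2$ on $V^{\otimes 3}$; a specific braiding is an invertible weak braiding. A shelf in $\mathcal{C}$ is an object $V$ with morphisms $\Delta:V\to V\otimes V$ and $\lhd:V\otimes V\to V$ such that: (1) $\Delta$ is coassociative, $\Delta_1\circ\Delta=\Delta_2\circ\Delta$, and weakly cocommutative, $c_2\circ\Delta^3=\Delta^3:V\to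 V^{\otimes 4}$; (2) (generalized self-distributivity, GSD) $\lhd^2=\lhd\circ(\lhd\otimes\lhd)\circ c_2\circ\Delta_3:V^{\otimes3}\to V$; (3) (compatibility) $\Delta\circ\lhd=(\lhd\otimes\lhd)\circ c_2\circ(\Delta\otimes\Delta):V^{\otimes2}\to V^{\otimes2}$. A rack in $\mathcal{C}$ is a shelf endowed moreover with a right counit $\varepsilon:V\to\mathbf{I}$, i.e. $\varepsilon_2\circ\Delta=\operatorname{Id}_V$, and a morphism $\widetilde{\lhd}:V\otimes V\to V$ with $\widetilde{\lhd}\circ\lhd_1\circ c_2\circ\Delta_2=\lhd\circ\widetilde{\lhd}_1\circ c_2\circ\Delta_2=\operatorname{Id}_V\otimes\varepsilon:V^{\otimes2}\to V$. *)

theory Defs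
  imports Main
begin

text \<open>
  A category has a carrier set of objects and a carrier set of arrows; composition
  \<open>g \<cdot> f\<close> is in applicative order and is only meaningful when \<open>Cod f = Dom g\<close>.
\<close>

record ('o, 'm) cat =
  Obj :: "'o set"
  Arr :: "'m set"
  Dom :: "'m \<Rightarrow> 'o"
  Cod :: "'m \<Rightarrow> 'o"
  Ident :: "'o \<Rightarrow> 'm"
  Comp :: "'m \<Rightarrow> 'm \<Rightarrow> 'm"  (infixr "\<cdot>\<index>" 65)

definition hom :: "('o, 'm, 'z) cat_scheme \<Rightarrow> 'o \<Rightarrow> 'o \<Rightarrow> 'm set" where
  "hom C A B = {f \<in> Arr C. Dom C f = A \<and> Cod C f = B}"

definition inverse_arrows :: "('o, 'm, 'z) cat_scheme \<Rightarrow> 'm \<Rightarrow> 'm \<Rightarrow> bool" where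
  "inverse_arrows C f g \<longleftrightarrow>
     f \<in> Arr C \<and> g \<in> hom C (Cod C f) (Dom C f) \<and>
     g \<cdot>\<^bsub>C\<^esub> f = Ident C (Dom C f) \<and> f \<cdot>\<^bsub>C\<^esub> g = Ident C (Cod C f)"

definition invertible :: "('o, 'm, 'z) cat_scheme \<Rightarrow> 'm \<Rightarrow> bool" where
  "invertible C f \<longleftrightarrow> (\<exists>g. inverse_arrows C f g)"

locale category =
  fixes C (structure)
  assumes Dom_in_Obj: "f \<in> Arr C \<Longrightarrow> Dom C f \<in> Obj C"
    and Cod_in_Obj: "f \<in> Arr C \<Longrightarrow> Cod C f \<in> Obj C"
    and Ident_in_hom: "A \<in> Obj C \<Longrightarrow> Ident C A \<in> hom C A A"
    and Comp_in_hom: "f \<in> hom C A B \<Longrightarrow> g \<in> hom C B D \<Longrightarrow> g \<cdot> f \<in> hom C A D"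
    and Comp_Ident_left: "f \<in> hom C A B \<Longrightarrow> Ident C B \<cdot> f = f"
    and Comp_Ident_right: "f \<in> hom C A B \<Longrightarrow> f \<cdot> Ident C A = f"
    and Comp_assoc:
      "f \<in> hom C A B \<Longrightarrow> g \<in> hom C B D \<Longrightarrow> h \<in> hom C D E \<Longrightarrow>
         h \<cdot> (g \<cdot> f) = (h \<cdot> g) \<cdot> f"

record ('o, 'm) moncat = "('o, 'm) cat" +
  Unit :: "'o"
  TensO :: "'o \<Rightarrow> 'o \<Rightarrow> 'o"  (infixr "\<boxtimes>\<index>" 70)
  TensA :: "'m \<Rightarrow> 'm \<Rightarrow> 'm"  (infixr "\<otimes>\<index>" 70)

text \<open>
  \<open>\<boxtimes>\<close> is the tensor product on objects and \<open>\<otimes>\<close> the one on arrows; strictness means that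
  associativity and the unit laws hold on the nose for both.
\<close>

locale strict_monoidal_category = category +
  assumes Unit_in_Obj: "Unit C \<in> Obj C"
    and TensO_in_Obj: "A \<in> Obj C \<Longrightarrow> B \<in> Obj C \<Longrightarrow> A \<boxtimes> B \<in> Obj C"
    and TensA_in_hom:
      "f \<in> hom C A B \<Longrightarrow> g \<in> hom C A' B' \<Longrightarrow> f \<otimes> g \<in> hom C (A \<boxtimes> A') (B \<boxtimes> B')"
    and TensA_Ident:
      "A \<in> Obj C \<Longrightarrow> B \<in> Obj C \<Longrightarrow> Ident C A \<otimes> Ident C B = Ident C (A \<boxtimes> B)"
    and TensA_Comp:
      "f \<in> hom C A B \<Longrightarrow> g \<in> hom C B D \<Longrightarrow> f' \<in> hom C A' B' \<Longrightarrow> g' \<in> hom C B' D' \<Longrightarrow>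
         (g \<cdot> f) \<otimes> (g' \<cdot> f') = (g \<otimes> g') \<cdot> (f \<otimes> f')"
    and TensO_assoc:
      "A \<in> Obj C \<Longrightarrow> B \<in> Obj C \<Longrightarrow> D \<in> Obj C \<Longrightarrow> (A \<boxtimes> B) \<boxtimes> D = A \<boxtimes> (B \<boxtimes> D)"
    and TensO_Unit_left: "A \<in> Obj C \<Longrightarrow> Unit C \<boxtimes> A = A"
    and TensO_Unit_right: "A \<in> Obj C \<Longrightarrow> A \<boxtimes> Unit C = A"
    and TensA_assoc:
      "f \<in> Arr C \<Longrightarrow> g \<in> Arr C \<Longrightarrow> h \<in> Arr C \<Longrightarrow> (f \<otimes> g) \<otimes> h = f \<otimes> (g \<otimes> h)"
    and TensA_Unit_left: "f \<in> Arr C \<Longrightarrow> Ident C (Unit C) \<otimes> f = f"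
    and TensA_Unit_right: "f \<in> Arr C \<Longrightarrow> f \<otimes> Ident C (Unit C) = f"

record ('o, 'm) symcat = "('o, 'm) moncat" +
  Braid :: "'o \<Rightarrow> 'o \<Rightarrow> 'm"

locale symmetric_category = strict_monoidal_category +
  assumes Braid_in_hom:
      "A \<in> Obj C \<Longrightarrow> B \<in> Obj C \<Longrightarrow> Braid C A B \<in> hom C (A \<boxtimes> B) (B \<boxtimes> A)"
    and Braid_natural:
      "f \<in> hom C A A' \<Longrightarrow> g \<in> hom C B B' \<Longrightarrow>
         Braid C A' B' \<cdot> (f \<otimes> g) = (g \<otimes> f) \<cdot> Braid C A B"
    and Braid_TensO_right:
      "A \<in> Obj C \<Longrightarrow> B \<in> Obj C \<Longrightarrow> D \<in> Obj C \<Longrightarrow>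
         Braid C A (B \<boxtimes> D) = (Ident C B \<otimes> Braid C A D) \<cdot> (Braid C A B \<otimes> Ident C D)"
    and Braid_TensO_left:
      "A \<in> Obj C \<Longrightarrow> B \<in> Obj C \<Longrightarrow> D \<in> Obj C \<Longrightarrow>
         Braid C (A \<boxtimes> B) D = (Braid C A D \<otimes> Ident C B) \<cdot> (Ident C A \<otimes> Braid C B D)"
    and Braid_symmetric:
      "A \<in> Obj C \<Longrightarrow> B \<in> Obj C \<Longrightarrow> Braid C B A \<cdot> Braid C A B = Ident C (A \<boxtimes> B)"

primrec tpow :: "('o, 'm, 'z) moncat_scheme \<Rightarrow> 'o \<Rightarrow> nat \<Rightarrow> 'o" where
  "tpow C V 0 = Unit C"
| "tpow C V (Suc n) = tpow C V n \<boxtimes>\<^bsub>C\<^esub> V"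

text \<open>
  For \<open>\<phi> : V\<^sup>l \<rightarrow> V\<^sup>r\<close>, \<open>leg C V k i \<phi>\<close> is the arrow \<open>\<phi>\<^sub>i : V\<^sup>k\<^sup>+\<^sup>l \<rightarrow> V\<^sup>k\<^sup>+\<^sup>r\<close>,
  where \<open>k\<close> is the total number of identity strands and \<open>1 \<le> i \<le> k + 1\<close>.
\<close>

definition leg :: "('o, 'm, 'z) moncat_scheme \<Rightarrow> 'o \<Rightarrow> nat \<Rightarrow> nat \<Rightarrow> 'm \<Rightarrow> 'm" where
  "leg C V k i \<phi> =
     Ident C (tpow C V (i - 1)) \<otimes>\<^bsub>C\<^esub> \<phi> \<otimes>\<^bsub>C\<^esub> Ident C (tpow C V (k + 1 - i))"

definition weak_braiding :: "('o, 'm, 'z) moncat_scheme \<Rightarrow> 'o \<Rightarrow> 'm \<Rightarrow> bool" where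
  "weak_braiding C V \<sigma> \<longleftrightarrow>
     V \<in> Obj C \<and> \<sigma> \<in> hom C (V \<boxtimes>\<^bsub>C\<^esub> V) (V \<boxtimes>\<^bsub>C\<^esub> V) \<and>
     leg C V 1 1 \<sigma> \<cdot>\<^bsub>C\<^esub> leg C V 1 2 \<sigma> \<cdot>\<^bsub>C\<^esub> leg C V 1 1 \<sigma>
       = leg C V 1 2 \<sigma> \<cdot>\<^bsub>C\<^esub> leg C V 1 1 \<sigma> \<cdot>\<^bsub>C\<^esub> leg C V 1 2 \<sigma>"

definition specific_braiding :: "('o, 'm, 'z) moncat_scheme \<Rightarrow> 'o \<Rightarrow> 'm \<Rightarrow> bool" where
  "specific_braiding C V \<sigma> \<longleftrightarrow> weak_braiding C V \<sigma> \<and> invertible C \<sigma>"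

text \<open>
  The iterates \<open>\<Delta>\<^sup>3 = \<Delta>\<^sub>1 \<cdot> \<Delta>\<^sub>1 \<cdot> \<Delta>\<^sub>1 : V \<rightarrow> V\<^sup>4\<close> and \<open>\<lhd>\<^sup>2 = \<lhd>\<^sub>1 \<cdot> \<lhd>\<^sub>1 : V\<^sup>3 \<rightarrow> V\<close> are
  written out below, since the number of identity strands changes from factor to factor.
  The self-distributive operation \<open>\<lhd>\<close> is called \<open>act\<close>, and \<open>act'\<close> is \<open>\<lhd>\<close> with a tilde.
\<close>

definition shelf :: "('o, 'm, 'z) symcat_scheme \<Rightarrow> 'o \<Rightarrow> 'm \<Rightarrow> 'm \<Rightarrow> bool" where
  "shelf C V \<Delta> act \<longleftrightarrow>
     V \<in> Obj C \<and> \<Delta> \<in> hom C V (V \<boxtimes>\<^bsub>C\<^esub> V) \<and> act \<in> hom C (V \<boxtimes>\<^bsub>C\<^esub> V) V \<and>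
     leg C V 1 1 \<Delta> \<cdot>\<^bsub>C\<^esub> \<Delta> = leg C V 1 2 \<Delta> \<cdot>\<^bsub>C\<^esub> \<Delta> \<and>
     leg C V 2 2 (Braid C V V) \<cdot>\<^bsub>C\<^esub> leg C V 2 1 \<Delta> \<cdot>\<^bsub>C\<^esub> leg C V 1 1 \<Delta> \<cdot>\<^bsub>C\<^esub> leg C V 0 1 \<Delta>
       = leg C V 2 1 \<Delta> \<cdot>\<^bsub>C\<^esub> leg C V 1 1 \<Delta> \<cdot>\<^bsub>C\<^esub> leg C V 0 1 \<Delta> \<and>
     leg C V 0 1 act \<cdot>\<^bsub>C\<^esub> leg C V 1 1 act
       = act \<cdot>\<^bsub>C\<^esub> (act \<otimes>\<^bsub>C\<^esub> act) \<cdot>\<^bsub>C\<^esub> leg C V 2 2 (Braid C V V) \<cdot>\<^bsub>C\<^esub> leg C V 2 3 \<Delta> \<and>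
     \<Delta> \<cdot>\<^bsub>C\<^esub> act
       = (act \<otimes>\<^bsub>C\<^esub> act) \<cdot>\<^bsub>C\<^esub> leg C V 2 2 (Braid C V V) \<cdot>\<^bsub>C\<^esub> (\<Delta> \<otimes>\<^bsub>C\<^esub> \<Delta>)"

definition rack :: "('o, 'm, 'z) symcat_scheme \<Rightarrow> 'o \<Rightarrow> 'm \<Rightarrow> 'm \<Rightarrow> 'm \<Rightarrow> 'm \<Rightarrow> bool" where
  "rack C V \<Delta> act \<epsilon> act' \<longleftrightarrow>
     shelf C V \<Delta> act \<and> \<epsilon> \<in> hom C V (Unit C) \<and> act' \<in> hom C (V \<boxtimes>\<^bsub>C\<^esub> V) V \<and>
     leg C V 1 2 \<epsilon> \<cdot>\<^bsub>C\<^esub> \<Delta> = Ident C V \<and>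
     act' \<cdot>\<^bsub>C\<^esub> leg C V 1 1 act \<cdot>\<^bsub>C\<^esub> leg C V 1 2 (Braid C V V) \<cdot>\<^bsub>C\<^esub> leg C V 1 2 \<Delta>
       = Ident C V \<otimes>\<^bsub>C\<^esub> \<epsilon> \<and>
     act \<cdot>\<^bsub>C\<^esub> leg C V 1 1 act' \<cdot>\<^bsub>C\<^esub> leg C V 1 2 (Braid C V V) \<cdot>\<^bsub>C\<^esub> leg C V 1 2 \<Delta>
       = Ident C V \<otimes>\<^bsub>C\<^esub> \<epsilon>"

definition shelf_braiding :: "('o, 'm, 'z) symcat_scheme \<Rightarrow> 'o \<Rightarrow> 'm \<Rightarrow> 'm \<Rightarrow> 'm" where
  "shelf_braiding C V \<Delta> act =
     leg C V 1 2 act \<cdot>\<^bsub>C\<^esub> leg C V 1 1 (Braid C V V) \<cdot>\<^bsub>C\<^esub> leg C V 1 2 \<Delta>"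

end

(*
  Morphisms between tensor powers of V are handled as words in whiskered generators
  id \<otimes> f \<otimes> id acting on a generalised element x, that is, an arbitrary arrow into a tensor
  power of V. Interchange, naturality of the symmetry, coassociativity and compatibility, read
  from left to right, bring a word into the form (actions)(permutation)(comultiplications).
  In Sweedler notation \<sigma>(a, b) = (b1, a \<lhd> b2). The two sides of the braid relation at (a, b, d) are
  (d1, b1 \<lhd> d2, (a \<lhd> b2) \<lhd> d3) and (d1, b1 \<lhd> d3, (a \<lhd> d2) \<lhd> (b2 \<lhd> d4)); self-distributivity
  rewrites the former to (d1, b1 \<lhd> d2, (a \<lhd> d3) \<lhd> (b2 \<lhd> d4)), and weak cocommutativity exchanges
  d2 and d3. The candidate inverse is (a, b) \<mapsto> (b \<lhd>~ a2, a1), so both composites collapse by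
  coassociativity, the rack axioms and the counit.
*)

theory Submission
  imports Defs
begin

text \<open>Positions must have a unique form for the word rules to match: \<open>1\<close>, never \<open>Suc 0\<close>.\<close>
declare tpow.simps(2) [simp del] One_nat_def [simp del] One_nat_def [symmetric, simp]

section \<open>Whiskered arrows between tensor powers of one object\<close>

locale symmetric_category_object = symmetric_category +
  fixes V
  assumes V_in_Obj: "V \<in> Obj C"
begin

abbreviation T :: "nat \<Rightarrow> _" where
  "T n \<equiv> tpow C V n"

abbreviation I :: "nat \<Rightarrow> _" where
  "I n \<equiv> Ident C (T n)"

abbreviation mor :: "nat \<Rightarrow> nat \<Rightarrow> _" where
  "mor p q \<equiv> hom C (T p) (T q)"

text \<open>Only the codomain is fixed. An equation stated at \<open>x\<close> therefore rewrites a
  right-nested word at any depth, the rest of the word being matched by \<open>x\<close>.\<close>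

definition elt :: "nat \<Rightarrow> _" where
  "elt n = {x \<in> Arr C. Cod C x = T n}"

text \<open>In contrast to \<open>leg\<close>, indexed by the numbers of strands on both sides, so
  that nested whiskering merely adds indices.\<close>

definition whisker :: "nat \<Rightarrow> _ \<Rightarrow> nat \<Rightarrow> _" where
  "whisker a f b = I a \<otimes> f \<otimes> I b"

lemma leg_eq_whisker: "leg C V k i \<phi> = whisker (i - 1) \<phi> (k + 1 - i)"
  by (simp add: leg_def whisker_def)

lemma T_in_Obj: "T n \<in> Obj C"
  by (induction n) (simp_all add: tpow.simps(2) Unit_in_Obj TensO_in_Obj V_in_Obj)

lemma T_1: "T 1 = V"
  using tpow.simps(2)[of C V 0] by (simp add: TensO_Unit_left V_in_Obj)

lemma T_2: "T 2 = V \<boxtimes> V"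
  using tpow.simps(2)[of C V 1] by (simp add: T_1)

lemma T_add: "T (m + n) = T m \<boxtimes> T n"
  by (induction n) (simp_all add: tpow.simps(2) TensO_Unit_right T_in_Obj TensO_assoc V_in_Obj)

lemma I_in_mor: "I n \<in> mor n n"
  by (simp add: Ident_in_hom T_in_Obj)

lemma I_add: "I m \<otimes> I n = I (m + n)"
  by (simp add: TensA_Ident T_in_Obj T_add)

lemma tensor_in_mor: "f \<in> mor p q \<Longrightarrow> g \<in> mor p' q' \<Longrightarrow> f \<otimes> g \<in> mor (p + p') (q + q')"
  by (simp add: T_add TensA_in_hom)

lemma hom_Arr: "f \<in> hom C A B \<Longrightarrow> f \<in> Arr C"
  by (simp add: hom_def)

lemma whisker_in_mor: "f \<in> mor p q \<Longrightarrow> whisker a f b \<in> mor (a + p + b) (a + q + b)"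
  unfolding whisker_def using tensor_in_mor I_in_mor by (metis add.assoc)

lemma whisker_0_0: "f \<in> mor p q \<Longrightarrow> whisker 0 f 0 = f"
  by (simp add: whisker_def TensA_Unit_left TensA_Unit_right hom_Arr)

lemma whisker_Ident: "whisker a (I n) b = I (a + n + b)"
  by (simp add: whisker_def I_add add.assoc)

lemma whisker_whisker:
  assumes f: "f \<in> mor p q"
  shows "whisker a (whisker a' f b') b = whisker (a + a') f (b' + b)"
proof -
  have A: "f \<in> Arr C" "I n \<in> Arr C" "f \<otimes> I n \<in> Arr C" "I n' \<otimes> f \<otimes> I n \<in> Arr C" for n n'
    using f tensor_in_mor[OF f I_in_mor] tensor_in_mor[OF I_in_mor tensor_in_mor[OF f I_in_mor]] I_in_mor
    by (auto simp: hom_def)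
  have B: "f \<otimes> I b' \<otimes> I b \<in> Arr C"
    using tensor_in_mor[OF f tensor_in_mor[OF I_in_mor I_in_mor]] by (rule hom_Arr)
  have "whisker a (whisker a' f b') b = I a \<otimes> I a' \<otimes> f \<otimes> I b' \<otimes> I b"
    by (simp add: whisker_def TensA_assoc A)
  also have "\<dots> = whisker (a + a') f (b' + b)"
    by (simp add: whisker_def TensA_assoc A B flip: I_add)
  finally show ?thesis .
qed

lemma Comp_assoc_elt:
  "f \<in> mor p q \<Longrightarrow> g \<in> mor q r \<Longrightarrow> x \<in> elt p \<Longrightarrow> (g \<cdot> f) \<cdot> x = g \<cdot> (f \<cdot> x)"
  by (rule Comp_assoc[symmetric, of x "Dom C x" _ _ _ g]) (auto simp: elt_def hom_def)

lemma Comp_in_elt: "f \<in> mor p q \<Longrightarrow> x \<in> elt p \<Longrightarrow> f \<cdot> x \<in> elt q"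
  using Comp_in_hom[of x "Dom C x" "T p" f "T q"] by (auto simp: elt_def hom_def)

lemma mor_elt: "f \<in> mor p q \<Longrightarrow> f \<in> elt q"
  by (simp add: elt_def hom_def)

lemma Ident_elt: "x \<in> elt n \<Longrightarrow> I n \<cdot> x = x"
  using Comp_Ident_left[of x "Dom C x" "T n"] by (auto simp: elt_def hom_def)

lemma whisker_in_elt:
  "f \<in> mor p q \<Longrightarrow> n = a + q + b \<Longrightarrow> x \<in> elt (a + p + b) \<Longrightarrow> whisker a f b \<cdot> x \<in> elt n"
  using Comp_in_elt whisker_in_mor by blast

lemma whisker_Comp:
  assumes f: "f \<in> mor p q" and g: "g \<in> mor q r"
  shows "whisker a (g \<cdot> f) b = whisker a g b \<cdot> whisker a f b"
proof -
  have "(g \<cdot> f) \<otimes> I b = (g \<otimes> I b) \<cdot> (f \<otimes> I b)"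
    using TensA_Comp[OF f g I_in_mor I_in_mor] Comp_Ident_left[OF I_in_mor] by simp
  then show ?thesis
    unfolding whisker_def
    using TensA_Comp[OF I_in_mor I_in_mor tensor_in_mor[OF f I_in_mor] tensor_in_mor[OF g I_in_mor]]
      Comp_Ident_left[OF I_in_mor] by simp
qed

lemma whisker_Comp_elt:
  assumes f: "f \<in> mor p q" and g: "g \<in> mor q r" and x: "x \<in> elt (a + p + b)"
  shows "whisker a (g \<cdot> f) b \<cdot> x = whisker a g b \<cdot> whisker a f b \<cdot> x"
  by (simp add: whisker_Comp[OF f g] Comp_assoc_elt[OF whisker_in_mor[OF f] whisker_in_mor[OF g] x])

text \<open>Bifunctoriality with identities inserted gives both orders of performing
  \<open>f\<close> and \<open>g\<close>; equating them is the interchange law.\<close>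

lemma tensor_eq:
  assumes f: "f \<in> mor p q" and g: "g \<in> mor p' q'"
  shows "f \<otimes> g = whisker 0 f q' \<cdot> whisker p g 0"
    and "f \<otimes> g = whisker q g 0 \<cdot> whisker 0 f p'"
proof -
  have A: "f \<in> Arr C" "g \<in> Arr C" "\<And>n. I n \<in> Arr C" "\<And>n. f \<otimes> I n \<in> Arr C" "\<And>n. I n \<otimes> g \<in> Arr C"
    using f g tensor_in_mor[OF f I_in_mor] tensor_in_mor[OF I_in_mor g] I_in_mor
    by (auto simp: hom_def)
  have w: "whisker 0 f n = f \<otimes> I n" "whisker n g 0 = I n \<otimes> g" for n
    by (simp_all add: whisker_def A TensA_Unit_left TensA_Unit_right)
  show "f \<otimes> g = whisker 0 f q' \<cdot> whisker p g 0"
    using TensA_Comp[OF I_in_mor f g I_in_mor]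
    by (simp add: w Comp_Ident_left[OF g] Comp_Ident_right[OF f])
  show "f \<otimes> g = whisker q g 0 \<cdot> whisker 0 f p'"
    using TensA_Comp[OF f I_in_mor I_in_mor g]
    by (simp add: w Comp_Ident_left[OF f] Comp_Ident_right[OF g])
qed

lemma whisker_interchange:
  assumes f: "f \<in> mor p q" and g: "g \<in> mor p' q'" and x: "x \<in> elt (a + p + b + p' + d)"
  shows "whisker a f (b + q' + d) \<cdot> whisker (a + p + b) g d \<cdot> x
       = whisker (a + q + b) g d \<cdot> whisker a f (b + p' + d) \<cdot> x"
proof -
  \<comment> \<open>The \<open>b\<close> strands lying between the two arrows are attached to
    \<open>g\<close>, so that \<open>f\<close> and the padded \<open>g\<close> become adjacent
    tensor factors.\<close>
  have g': "whisker b g 0 \<in> mor (b + p') (b + q')"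
    using whisker_in_mor[OF g, of b 0] by simp
  let ?fg = "whisker a (f \<otimes> whisker b g 0) d"
  have x': "x \<in> elt (a + (p + (b + p')) + d)"
    using x by (simp add: add.assoc)
  have 1: "?fg \<cdot> x = whisker a (whisker 0 f (b + q')) d \<cdot> whisker a (whisker p (whisker b g 0) 0) d \<cdot> x"
    unfolding tensor_eq(1)[OF f g']
    using whisker_Comp_elt[OF whisker_in_mor[OF g', of p 0, simplified]
      whisker_in_mor[OF f, of 0 "b+q'", simplified] x'] .
  have 2: "?fg \<cdot> x = whisker a (whisker q (whisker b g 0) 0) d \<cdot> whisker a (whisker 0 f (b + p')) d \<cdot> x"
    unfolding tensor_eq(2)[OF f g']
    using whisker_Comp_elt[OF whisker_in_mor[OF f, of 0 "b+p'", simplified]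
      whisker_in_mor[OF g', of q 0, simplified] x'] .
  show ?thesis
    using 1 2 by (simp add: whisker_whisker[OF f] whisker_whisker[OF g] whisker_whisker[OF g'] add.assoc)
qed

text \<open>Interchange with four independent indices and subtraction: the left-hand side matches
  any two letters with numeral indices, and the side conditions become arithmetic. Here the letter
  applied first, \<open>g\<close>, lies to the right of \<open>f\<close>.\<close>

lemma whisker_swap_right:
  assumes f: "f \<in> mor p q" and g: "g \<in> mor p' q'"
    and "a + p \<le> a'" "a + p + b = a' + q' + b'" and x: "x \<in> elt (a' + p' + b')"
  shows "whisker a f b \<cdot> whisker a' g b' \<cdot> x
       = whisker (a' - p + q) g b' \<cdot> whisker a f (b - q' + p') \<cdot> x"
proof -
  define k where "k = a' - a - p"
  have "a' = a + p + k" "b = k + q' + b'"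
    using assms by (auto simp: k_def)
  then show ?thesis
    using whisker_interchange[OF f g, of x a k b'] x by (simp add: ac_simps)
qed

lemma whisker_swap_left:
  assumes f: "f \<in> mor p q" and g: "g \<in> mor p' q'"
    and "a' + q' \<le> a" "a + p + b = a' + q' + b'" and x: "x \<in> elt (a' + p' + b')"
  shows "whisker a f b \<cdot> whisker a' g b' \<cdot> x
       = whisker a' g (b' - p + q) \<cdot> whisker (a - q' + p') f b \<cdot> x"
proof -
  define k where "k = a - a' - q'"
  have "a = a' + q' + k" "b' = k + p + b"
    using assms by (auto simp: k_def)
  then show ?thesis
    using whisker_interchange[OF g f, of x a' k b] x by (simp add: ac_simps)
qed

section \<open>The symmetry on tensor powers: naturality and the Yang-Baxter equation\<close>

abbreviation c where
  "c \<equiv> Braid C V V"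

lemma c_in_mor: "c \<in> mor 2 2"
  by (simp only: T_2 Braid_in_hom V_in_Obj)

text \<open>The hexagon law with two units makes this crossing idempotent, and symmetry gives it a
  left inverse; hence it is the identity.\<close>

lemma Braid_Unit_right:
  assumes A: "A \<in> Obj C"
  shows "Braid C A (Unit C) = Ident C A"
proof -
  let ?b = "Braid C A (Unit C)" and ?b' = "Braid C (Unit C) A"
  have b: "?b \<in> hom C A A" and b': "?b' \<in> hom C A A"
    using Braid_in_hom[OF A Unit_in_Obj] Braid_in_hom[OF Unit_in_Obj A]
    by (simp_all add: TensO_Unit_left TensO_Unit_right A)
  have inv: "?b' \<cdot> ?b = Ident C A"
    using Braid_symmetric[OF A Unit_in_Obj] by (simp add: TensO_Unit_right A)
  have "?b \<cdot> ?b = ?b"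
    using Braid_TensO_right[OF A Unit_in_Obj Unit_in_Obj] b
    by (simp add: TensO_Unit_left Unit_in_Obj TensA_Unit_left TensA_Unit_right hom_Arr)
  then have "(?b' \<cdot> ?b) \<cdot> ?b = ?b' \<cdot> ?b"
    using Comp_assoc[OF b b b'] by simp
  then show ?thesis
    by (simp add: inv Comp_Ident_left[OF b])
qed

text \<open>By the hexagon law a crossing with a block of two strands is two elementary crossings,
  which turns naturality into an equation of words.\<close>

lemma Braid_2_1: "Braid C (T 2) (T 1) = whisker 0 c 1 \<cdot> whisker 1 c 0"
  using Braid_TensO_left[of V V V]
  by (simp add: T_2 T_1 whisker_def TensA_Unit_left TensA_Unit_right V_in_Obj
      hom_Arr[OF c_in_mor] hom_Arr[OF tensor_in_mor[OF c_in_mor I_in_mor, of 1, simplified T_1]]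
      hom_Arr[OF tensor_in_mor[OF I_in_mor c_in_mor, of 1, simplified T_1]])

lemma Braid_1_2: "Braid C (T 1) (T 2) = whisker 1 c 0 \<cdot> whisker 0 c 1"
  using Braid_TensO_right[of V V V]
  by (simp add: T_2 T_1 whisker_def TensA_Unit_left TensA_Unit_right V_in_Obj
      hom_Arr[OF c_in_mor] hom_Arr[OF tensor_in_mor[OF c_in_mor I_in_mor, of 1, simplified T_1]]
      hom_Arr[OF tensor_in_mor[OF I_in_mor c_in_mor, of 1, simplified T_1]])

text \<open>Peels the outermost letter off a whiskered word. Repeated use carries an equation
  between closed words to any position.\<close>

lemma whisker_Comp_whisker:
  assumes g: "g \<in> mor p q" and h: "h \<in> mor n (a' + p + b')" and x: "x \<in> elt (a + n + b)"
  shows "whisker a (whisker a' g b' \<cdot> h) b \<cdot> x = whisker (a + a') g (b' + b) \<cdot> whisker a h b \<cdot> x"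
  using whisker_Comp_elt[OF h whisker_in_mor[OF g] x] by (simp add: whisker_whisker[OF g])

lemma whisker_mor: "f \<in> mor p q \<Longrightarrow> m = a + p + b \<Longrightarrow> n = a + q + b \<Longrightarrow> whisker a f b \<in> mor m n"
  by (simp only: whisker_in_mor)

lemma whisker_Comp_mor:
  "f \<in> mor p q \<Longrightarrow> n = a + q + b \<Longrightarrow> h \<in> mor m (a + p + b) \<Longrightarrow> whisker a f b \<cdot> h \<in> mor m n"
  using Comp_in_hom whisker_in_mor by blast

lemma tensor_I: "f \<in> mor p q \<Longrightarrow> f \<otimes> I n = whisker 0 f n"
  and I_tensor: "f \<in> mor p q \<Longrightarrow> I n \<otimes> f = whisker n f 0"
  using tensor_in_mor[OF _ I_in_mor, of f p q n] tensor_in_mor[OF I_in_mor, of f p q n]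
  by (simp_all add: whisker_def TensA_Unit_left TensA_Unit_right hom_Arr)

lemma c_c:
  assumes "x \<in> elt (a + 2 + b)"
  shows "whisker a c b \<cdot> whisker a c b \<cdot> x = x"
proof -
  have "c \<cdot> c = I 2"
    using Braid_symmetric[OF V_in_Obj V_in_Obj] by (simp only: T_2)
  then show ?thesis
    using assms
    by (simp add: whisker_Comp_elt[OF c_in_mor c_in_mor, symmetric] whisker_Ident Ident_elt)
qed

lemma Braid_1_1: "Braid C (T 1) (T 1) = whisker 0 c 0"
  by (simp add: T_1 whisker_0_0[OF c_in_mor])

lemmas whisker_simps = whisker_mor whisker_Comp_mor whisker_whisker

text \<open>Naturality is first written as a closed equation on three strands and then whiskered.
  Read left to right, the arrow of type \<open>mor 2 1\<close> moves past the crossings to the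
  output end.\<close>

lemma c_natural_2_1_left:
  assumes f: "f \<in> mor 2 1" and x: "x \<in> elt (a + 3 + b)" and eqs: "b' = b + 1"
  shows "whisker a c b \<cdot> whisker a f b' \<cdot> x
       = whisker (a + 1) f b \<cdot> whisker a c b' \<cdot> whisker (a + 1) c b \<cdot> x"
proof -
  have "whisker 0 c 0 \<cdot> whisker 0 f 1 = whisker 1 f 0 \<cdot> whisker 0 c 1 \<cdot> whisker 1 c 0"
    using Braid_natural[OF f I_in_mor[of 1]]
    by (simp add: tensor_I[OF f] I_tensor[OF f] Braid_1_1 Braid_2_1)
  from arg_cong[OF this, of "\<lambda>f. whisker a f b \<cdot> x"] x show ?thesis
    by (simp add: f c_in_mor whisker_Comp_whisker[where n=3, OF f] whisker_Comp_whisker[where n=3, OF c_in_mor]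
        whisker_simps[OF f] whisker_simps[OF c_in_mor] ac_simps eqs)
qed

lemma c_natural_2_1_right:
  assumes f: "f \<in> mor 2 1" and x: "x \<in> elt (a + 3 + b)" and eqs: "a' = a + 1"
  shows "whisker a c b \<cdot> whisker a' f b \<cdot> x
       = whisker a f (b + 1) \<cdot> whisker a' c b \<cdot> whisker a c (b + 1) \<cdot> x"
proof -
  have "whisker 0 c 0 \<cdot> whisker 1 f 0 = whisker 0 f 1 \<cdot> whisker 1 c 0 \<cdot> whisker 0 c 1"
    using Braid_natural[OF I_in_mor[of 1] f]
    by (simp add: tensor_I[OF f] I_tensor[OF f] Braid_1_1 Braid_1_2)
  from arg_cong[OF this, of "\<lambda>f. whisker a f b \<cdot> x"] x show ?thesis
    by (simp add: f c_in_mor whisker_Comp_whisker[where n=3, OF f] whisker_Comp_whisker[where n=3, OF c_in_mor]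
        whisker_simps[OF f] whisker_simps[OF c_in_mor] ac_simps eqs)
qed

text \<open>Oriented opposite to the rules for \<open>mor 2 1\<close>: a comultiplication moves to
  the input end.\<close>

lemma c_natural_1_2_left:
  assumes f: "f \<in> mor 1 2" and x: "x \<in> elt (a + 2 + b)" and eqs: "b' = b + 1"
  shows "whisker a f b' \<cdot> whisker a c b \<cdot> x
       = whisker (a + 1) c b \<cdot> whisker a c b' \<cdot> whisker (a + 1) f b \<cdot> x"
proof -
  have "whisker 0 f 1 \<cdot> whisker 0 c 0 = (whisker 1 c 0 \<cdot> whisker 0 c 1) \<cdot> whisker 1 f 0"
    using Braid_natural[OF I_in_mor[of 1] f]
    by (simp add: tensor_I[OF f] I_tensor[OF f] Braid_1_1 Braid_1_2)
  \<comment> \<open>The expanded block crossing arrives as a bracketed pair, whereas words are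
    right-nested.\<close>
  also have "\<dots> = whisker 1 c 0 \<cdot> whisker 0 c 1 \<cdot> whisker 1 f 0"
    by (rule Comp_assoc[symmetric, of _ "T 2" "T 3" _ "T 3" _ "T 3"])
      (simp_all add: whisker_simps[OF f] whisker_simps[OF c_in_mor])
  finally have "whisker 0 f 1 \<cdot> whisker 0 c 0 = whisker 1 c 0 \<cdot> whisker 0 c 1 \<cdot> whisker 1 f 0" .
  from arg_cong[OF this, of "\<lambda>f. whisker a f b \<cdot> x"] x show ?thesis
    by (simp add: f c_in_mor whisker_Comp_whisker[where n=2, OF f] whisker_Comp_whisker[where n=2, OF c_in_mor]
        whisker_simps[OF f] whisker_simps[OF c_in_mor] ac_simps eqs)
qed

lemma c_natural_1_2_right:
  assumes f: "f \<in> mor 1 2" and x: "x \<in> elt (a + 2 + b)" and eqs: "a' = a + 1"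
  shows "whisker a' f b \<cdot> whisker a c b \<cdot> x
       = whisker a c (b + 1) \<cdot> whisker a' c b \<cdot> whisker a f (b + 1) \<cdot> x"
proof -
  have "whisker 1 f 0 \<cdot> whisker 0 c 0 = (whisker 0 c 1 \<cdot> whisker 1 c 0) \<cdot> whisker 0 f 1"
    using Braid_natural[OF f I_in_mor[of 1]]
    by (simp add: tensor_I[OF f] I_tensor[OF f] Braid_1_1 Braid_2_1)
  also have "\<dots> = whisker 0 c 1 \<cdot> whisker 1 c 0 \<cdot> whisker 0 f 1"
    by (rule Comp_assoc[symmetric, of _ "T 2" "T 3" _ "T 3" _ "T 3"])
      (simp_all add: whisker_simps[OF f] whisker_simps[OF c_in_mor])
  finally have "whisker 1 f 0 \<cdot> whisker 0 c 0 = whisker 0 c 1 \<cdot> whisker 1 c 0 \<cdot> whisker 0 f 1" .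
  from arg_cong[OF this, of "\<lambda>f. whisker a f b \<cdot> x"] x show ?thesis
    by (simp add: f c_in_mor whisker_Comp_whisker[where n=2, OF f] whisker_Comp_whisker[where n=2, OF c_in_mor]
        whisker_simps[OF f] whisker_simps[OF c_in_mor] ac_simps eqs)
qed

text \<open>Naturality turns the crossing into one with the unit, which is trivial by
  \<open>Braid_Unit_right\<close>: a strand about to be erased has nothing to cross.\<close>

lemma c_natural_1_0_left:
  assumes f: "f \<in> mor 1 0" and x: "x \<in> elt (a + 2 + b)" and eqs: "b' = b + 1"
  shows "whisker a f b' \<cdot> whisker a c b \<cdot> x = whisker (a + 1) f b \<cdot> x"
proof -
  have "whisker 0 f 1 \<cdot> whisker 0 c 0 = whisker 1 f 0"
    using Braid_natural[OF I_in_mor[of 1] f] whisker_mor[OF f, of 2 1 0 1]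
    by (simp add: tensor_I[OF f] I_tensor[OF f] Braid_1_1 Braid_Unit_right T_in_Obj Comp_Ident_left)
  from arg_cong[OF this, of "\<lambda>f. whisker a f b \<cdot> x"] x show ?thesis
    by (simp add: f c_in_mor whisker_Comp_whisker[where n=2, OF f] whisker_Comp_whisker[where n=2, OF c_in_mor]
        whisker_simps[OF f] whisker_simps[OF c_in_mor] ac_simps eqs)
qed

text \<open>This is the left version at \<open>whisker a c b \<cdot> x\<close>, where two crossings
  cancel.\<close>

lemma c_natural_1_0_right:
  assumes f: "f \<in> mor 1 0" and x: "x \<in> elt (a + 2 + b)" and eqs: "a' = a + 1"
  shows "whisker a' f b \<cdot> whisker a c b \<cdot> x = whisker a f (b + 1) \<cdot> x"
  using c_natural_1_0_left[OF f _ refl, of "whisker a c b \<cdot> x" a b] x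
  by (simp add: whisker_in_elt[OF c_in_mor] c_c eqs)

text \<open>
  Side conditions such as \<open>a' = a + 1\<close> let the rules match numerals. With \<open>a'\<close> and \<open>b'\<close> on the
  right-hand side of the next one, it would be permutative and the simplifier would not use it freely.
\<close>
lemma c_yang_baxter:
  assumes x: "x \<in> elt (a + 3 + b)" and eqs: "a' = a + 1" "b' = b + 1"
  shows "whisker a' c b \<cdot> whisker a c b' \<cdot> whisker a' c b \<cdot> x
       = whisker a c (b + 1) \<cdot> whisker (a + 1) c b \<cdot> whisker a c (b + 1) \<cdot> x"
proof -
  \<comment> \<open>The symmetry is natural with respect to its own component \<open>c\<close>,
    which slides past the third strand.\<close>
  have "(whisker 0 c 1 \<cdot> whisker 1 c 0) \<cdot> whisker 0 c 1 = whisker 1 c 0 \<cdot> whisker 0 c 1 \<cdot> whisker 1 c 0"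
    using Braid_natural[OF c_in_mor I_in_mor[of 1]]
    by (simp add: tensor_I[OF c_in_mor] I_tensor[OF c_in_mor] Braid_2_1)
  moreover have "(whisker 0 c 1 \<cdot> whisker 1 c 0) \<cdot> whisker 0 c 1 = whisker 0 c 1 \<cdot> whisker 1 c 0 \<cdot> whisker 0 c 1"
    by (rule Comp_assoc[symmetric, of _ "T 3" "T 3" _ "T 3" _ "T 3"])
      (simp_all add: whisker_simps[OF c_in_mor])
  ultimately have "whisker 0 c 1 \<cdot> whisker 1 c 0 \<cdot> whisker 0 c 1 = whisker 1 c 0 \<cdot> whisker 0 c 1 \<cdot> whisker 1 c 0"
    by simp
  from arg_cong[OF this, of "\<lambda>f. whisker a f b \<cdot> x"] x show ?thesis
    by (simp add: c_in_mor whisker_Comp_whisker[where n=3, OF c_in_mor] whisker_simps[OF c_in_mor] ac_simps eqs)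
qed

text \<open>A tensor product such as \<open>act \<otimes> act\<close> in the shelf axioms expands to
  a bracketed two-letter word; this removes the brackets.\<close>

lemma whisker_Comp2_assoc:
  assumes "f \<in> mor p q" "g \<in> mor p' q'" "a + p + b = a' + q' + b'" "x \<in> elt (a' + p' + b')"
  shows "(whisker a f b \<cdot> whisker a' g b') \<cdot> x = whisker a f b \<cdot> whisker a' g b' \<cdot> x"
  using assms by (metis Comp_assoc_elt whisker_in_mor)

end

section \<open>The shelf axioms as rules on words\<close>

locale shelf_object = symmetric_category_object +
  fixes \<Delta> act
  assumes shelf: "shelf C V \<Delta> act"
begin

lemma \<Delta>_in_mor: "\<Delta> \<in> mor 1 2" and act_in_mor: "act \<in> mor 2 1"
  using shelf by (simp_all add: shelf_def T_1 T_2)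

lemmas word_simps =
  whisker_simps[OF c_in_mor] whisker_simps[OF \<Delta>_in_mor] whisker_simps[OF act_in_mor]
  mor_elt c_in_mor \<Delta>_in_mor act_in_mor

lemmas word_Comp = whisker_Comp_whisker[OF c_in_mor] whisker_Comp_whisker[OF \<Delta>_in_mor] whisker_Comp_whisker[OF act_in_mor]

text \<open>In this orientation every iterated comultiplication becomes a right comb.\<close>

lemma coassoc:
  assumes x: "x \<in> elt (a + 1 + b)" and eqs: "b' = b + 1"
  shows "whisker a \<Delta> b' \<cdot> whisker a \<Delta> b \<cdot> x = whisker (a + 1) \<Delta> b \<cdot> whisker a \<Delta> b \<cdot> x"
proof -
  have "whisker 0 \<Delta> 1 \<cdot> whisker 0 \<Delta> 0 = whisker 1 \<Delta> 0 \<cdot> whisker 0 \<Delta> 0"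
    using shelf by (simp add: shelf_def leg_eq_whisker whisker_0_0[OF \<Delta>_in_mor])
  from arg_cong[OF this, of "\<lambda>f. whisker a f b \<cdot> x"] x show ?thesis
    by (simp add: word_Comp[where n=1] word_simps ac_simps eqs)
qed

lemma weak_cocomm:
  assumes x: "x \<in> elt (a + 1 + b)"
  shows "whisker (a + 1) c (b + 1) \<cdot> whisker a \<Delta> (b + 2) \<cdot> whisker a \<Delta> (b + 1) \<cdot> whisker a \<Delta> b \<cdot> x
    = whisker a \<Delta> (b + 2) \<cdot> whisker a \<Delta> (b + 1) \<cdot> whisker a \<Delta> b \<cdot> x"
proof -
  have "whisker 1 c 1 \<cdot> whisker 0 \<Delta> 2 \<cdot> whisker 0 \<Delta> 1 \<cdot> whisker 0 \<Delta> 0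
    = whisker 0 \<Delta> 2 \<cdot> whisker 0 \<Delta> 1 \<cdot> whisker 0 \<Delta> 0"
    using shelf by (simp add: shelf_def leg_eq_whisker)
  from arg_cong[OF this, of "\<lambda>f. whisker a f b \<cdot> x"] x show ?thesis
    by (simp add: word_Comp[where n=1] word_simps ac_simps)
qed

lemma compat:
  assumes x: "x \<in> elt (a + 2 + b)"
  shows "whisker a \<Delta> b \<cdot> whisker a act b \<cdot> x = whisker a act (b + 1) \<cdot> whisker (a + 2) act b
    \<cdot> whisker (a + 1) c (b + 1) \<cdot> whisker a \<Delta> (b + 2) \<cdot> whisker (a + 1) \<Delta> b \<cdot> x"
proof -
  have "whisker 0 \<Delta> 0 \<cdot> whisker 0 act 0 =
    (whisker 0 act 1 \<cdot> whisker 2 act 0) \<cdot> whisker 1 c 1 \<cdot> whisker 0 \<Delta> 2 \<cdot> whisker 1 \<Delta> 0"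
    using shelf tensor_eq(1)[OF act_in_mor act_in_mor] tensor_eq(1)[OF \<Delta>_in_mor \<Delta>_in_mor]
    by (simp add: shelf_def leg_eq_whisker whisker_0_0[OF \<Delta>_in_mor] whisker_0_0[OF act_in_mor])
  also have "\<dots> = whisker 0 act 1 \<cdot> whisker 2 act 0 \<cdot> whisker 1 c 1 \<cdot> whisker 0 \<Delta> 2 \<cdot> whisker 1 \<Delta> 0"
    by (rule whisker_Comp2_assoc[OF act_in_mor act_in_mor]) (simp_all add: word_simps mor_elt[where p=2])
  finally have "whisker 0 \<Delta> 0 \<cdot> whisker 0 act 0 = whisker 0 act 1 \<cdot> whisker 2 act 0 \<cdot> whisker 1 c 1 \<cdot> whisker 0 \<Delta> 2 \<cdot> whisker 1 \<Delta> 0" .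
  from arg_cong[OF this, of "\<lambda>f. whisker a f b \<cdot> x"] x show ?thesis
    by (simp add: word_Comp[where n=2] word_simps ac_simps)
qed

text \<open>The right-hand side contains an instance of the left-hand side, so as a rewrite rule
  this would loop; it stays out of \<open>normalize\<close>.\<close>

lemma gsd:
  assumes x: "x \<in> elt (a + 3 + b)" and eqs: "b' = b + 1"
  shows "whisker a act b \<cdot> whisker a act b' \<cdot> x = whisker a act b \<cdot> whisker a act b' \<cdot> whisker (a + 2) act b
    \<cdot> whisker (a + 1) c b' \<cdot> whisker (a + 2) \<Delta> b \<cdot> x"
proof -
  have "whisker 0 act 0 \<cdot> whisker 0 act 1 =
    whisker 0 act 0 \<cdot> (whisker 0 act 1 \<cdot> whisker 2 act 0) \<cdot> whisker 1 c 1 \<cdot> whisker 2 \<Delta> 0"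
    using shelf tensor_eq(1)[OF act_in_mor act_in_mor]
    by (simp add: shelf_def leg_eq_whisker whisker_0_0[OF act_in_mor])
  also have "\<dots> = whisker 0 act 0 \<cdot> whisker 0 act 1 \<cdot> whisker 2 act 0 \<cdot> whisker 1 c 1 \<cdot> whisker 2 \<Delta> 0"
    by (rule arg_cong[OF whisker_Comp2_assoc[OF act_in_mor act_in_mor]]) (simp_all add: word_simps mor_elt[where p=3])
  finally have "whisker 0 act 0 \<cdot> whisker 0 act 1 = whisker 0 act 0 \<cdot> whisker 0 act 1 \<cdot> whisker 2 act 0 \<cdot> whisker 1 c 1 \<cdot> whisker 2 \<Delta> 0" .
  from arg_cong[OF this, of "\<lambda>f. whisker a f b \<cdot> x"] x show ?thesis
    by (simp add: word_Comp[where n=3] word_simps ac_simps eqs)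
qed

lemmas elt_simps = whisker_in_elt[OF c_in_mor] whisker_in_elt[OF \<Delta>_in_mor] whisker_in_elt[OF act_in_mor]

text \<open>Actions move outward past crossings and comultiplications, and crossings past
  comultiplications. Letters of one kind are swapped in one direction only, which orders them by
  position and avoids loops.\<close>

lemmas normalize =
  whisker_swap_left[OF act_in_mor act_in_mor] whisker_swap_left[OF c_in_mor c_in_mor]
  whisker_swap_right[OF \<Delta>_in_mor \<Delta>_in_mor]
  whisker_swap_left[OF c_in_mor act_in_mor] whisker_swap_right[OF c_in_mor act_in_mor]
  whisker_swap_left[OF \<Delta>_in_mor act_in_mor] whisker_swap_right[OF \<Delta>_in_mor act_in_mor]
  whisker_swap_left[OF \<Delta>_in_mor c_in_mor] whisker_swap_right[OF \<Delta>_in_mor c_in_mor]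
  c_c c_yang_baxter
  c_natural_2_1_left[OF act_in_mor] c_natural_2_1_right[OF act_in_mor]
  c_natural_1_2_left[OF \<Delta>_in_mor] c_natural_1_2_right[OF \<Delta>_in_mor]
  coassoc compat

section \<open>The braid relation\<close>

abbreviation \<sigma> where "\<sigma> \<equiv> shelf_braiding C V \<Delta> act"

lemma \<sigma>_eq: "\<sigma> = whisker 1 act 0 \<cdot> whisker 0 c 1 \<cdot> whisker 1 \<Delta> 0"
  by (simp add: shelf_braiding_def leg_eq_whisker)

lemma whisker_\<sigma>:
  "x \<in> elt (a + 2 + b) \<Longrightarrow>
    whisker a \<sigma> b \<cdot> x = whisker (a + 1) act b \<cdot> whisker a c (b + 1) \<cdot> whisker (a + 1) \<Delta> b \<cdot> x"
  unfolding \<sigma>_eq by (simp add: word_Comp[where n=2] word_simps ac_simps)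

lemma yang_baxter:
  assumes x: "x \<in> elt 3"
  shows "whisker 0 \<sigma> 1 \<cdot> whisker 1 \<sigma> 0 \<cdot> whisker 0 \<sigma> 1 \<cdot> x = whisker 1 \<sigma> 0 \<cdot> whisker 0 \<sigma> 1 \<cdot> whisker 1 \<sigma> 0 \<cdot> x"
proof -
  \<comment> \<open>In Sweedler notation \<open>y\<close> is (a, b1, d1, b2, d2, d3, d4), the
    longest common initial stage needed: both sides, once self-distributivity is used, are words
    applied to it.\<close>
  define y where "y = whisker 2 c 3 \<cdot> whisker 5 \<Delta> 0 \<cdot> whisker 4 \<Delta> 0 \<cdot> whisker 3 \<Delta> 0 \<cdot> whisker 1 \<Delta> 1 \<cdot> x"
  have y: "y \<in> elt 7"
    by (simp add: y_def x elt_simps)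
  \<comment> \<open>This crossing exchanges d2 and d3, the middle two of the four copies of d, and
    is disjoint from the crossing inside \<open>y\<close>.\<close>
  have "whisker 4 c 1 \<cdot> y = y"
    using weak_cocomm[of "whisker 1 \<Delta> 1 \<cdot> x" 3 0]
    by (simp add: y_def normalize x elt_simps)
  \<comment> \<open>Yang-Baxter moves the exchange of d2 and d3 next to \<open>y\<close>, which
    absorbs it.\<close>
  then have swap: "whisker 3 c 2 \<cdot> whisker 4 c 1 \<cdot> whisker 3 c 2 \<cdot> y = whisker 4 c 1 \<cdot> whisker 3 c 2 \<cdot> y"
    using c_yang_baxter[of y 3 1 4 2] y by simp
  have "whisker 0 \<sigma> 1 \<cdot> whisker 1 \<sigma> 0 \<cdot> whisker 0 \<sigma> 1 \<cdot> x =
    whisker 1 act 1 \<cdot> whisker 3 act 0 \<cdot> whisker 3 act 1 \<cdot>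
      whisker 0 c 4 \<cdot> whisker 2 c 2 \<cdot> whisker 1 c 3 \<cdot> whisker 0 c 4 \<cdot> whisker 3 c 1 \<cdot> whisker 2 c 2 \<cdot>
      whisker 4 \<Delta> 0 \<cdot> whisker 3 \<Delta> 0 \<cdot> whisker 1 \<Delta> 1 \<cdot> x"
    by (simp add: whisker_\<sigma> normalize x elt_simps)
  also have "\<dots> = whisker 1 act 1 \<cdot> whisker 3 act 0 \<cdot> whisker 3 act 1 \<cdot> whisker 5 act 0 \<cdot>
      whisker 0 c 5 \<cdot> whisker 2 c 3 \<cdot> whisker 1 c 4 \<cdot> whisker 0 c 5 \<cdot> whisker 4 c 1 \<cdot> whisker 3 c 2 \<cdot> y"
    \<comment> \<open>A single use of self-distributivity, on the third output (a \<lhd> b2) \<lhd>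
      d3.\<close>
    by (subst gsd[of _ 3 0]) (simp_all add: y_def normalize x elt_simps)
  also have "\<dots> = whisker 1 act 1 \<cdot> whisker 3 act 0 \<cdot> whisker 3 act 1 \<cdot> whisker 5 act 0 \<cdot>
      whisker 0 c 5 \<cdot> whisker 2 c 3 \<cdot> whisker 1 c 4 \<cdot> whisker 0 c 5 \<cdot>
      whisker 3 c 2 \<cdot> whisker 4 c 1 \<cdot> whisker 3 c 2 \<cdot> y"
    by (simp only: swap)
  also have "\<dots> = whisker 1 \<sigma> 0 \<cdot> whisker 0 \<sigma> 1 \<cdot> whisker 1 \<sigma> 0 \<cdot> x"
    by (simp add: y_def whisker_\<sigma> normalize x elt_simps)
  finally show ?thesis .
qed

lemma \<sigma>_in_mor: "\<sigma> \<in> mor 2 2"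
  by (simp add: \<sigma>_eq word_simps)

lemma weak_braiding_\<sigma>: "weak_braiding C V \<sigma>"
proof -
  \<comment> \<open>Evaluating \<open>yang_baxter\<close> at the identity arrow yields the equation
    of arrows; this rule erases the trailing identity.\<close>
  have [simp]: "whisker a \<sigma> b \<cdot> I 3 = whisker a \<sigma> b" if "a + 2 + b = 3" for a b
    using whisker_in_mor[OF \<sigma>_in_mor, of a b] that by (simp add: Comp_Ident_right)
  have "leg C V 1 1 \<sigma> \<cdot> leg C V 1 2 \<sigma> \<cdot> leg C V 1 1 \<sigma> = leg C V 1 2 \<sigma> \<cdot> leg C V 1 1 \<sigma> \<cdot> leg C V 1 2 \<sigma>"
    using yang_baxter[OF mor_elt[OF I_in_mor[of 3]]] by (simp add: leg_eq_whisker)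
  then show ?thesis
    using \<sigma>_in_mor by (simp add: weak_braiding_def V_in_Obj T_2)
qed

end

section \<open>Racks: the inverse of the braiding\<close>

locale rack_object = shelf_object +
  fixes \<epsilon> act'
  assumes rack: "rack C V \<Delta> act \<epsilon> act'"
begin

lemma \<epsilon>_in_mor: "\<epsilon> \<in> mor 1 0" and act'_in_mor: "act' \<in> mor 2 1"
  using rack by (simp_all add: rack_def T_1 T_2)

lemmas rack_word_simps = word_simps whisker_simps[OF \<epsilon>_in_mor] whisker_simps[OF act'_in_mor] \<epsilon>_in_mor act'_in_mor

lemmas rack_word_Comp = word_Comp whisker_Comp_whisker[OF \<epsilon>_in_mor] whisker_Comp_whisker[OF act'_in_mor]

lemma counit:
  assumes x: "x \<in> elt (a + 1 + b)" and eqs: "a' = a + 1"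
  shows "whisker a' \<epsilon> b \<cdot> whisker a \<Delta> b \<cdot> x = x"
proof -
  have "whisker 1 \<epsilon> 0 \<cdot> whisker 0 \<Delta> 0 = I 1"
    using rack by (simp add: rack_def leg_eq_whisker whisker_0_0[OF \<Delta>_in_mor] T_1)
  from arg_cong[OF this, of "\<lambda>f. whisker a f b \<cdot> x"] x show ?thesis
    by (simp add: rack_word_Comp[where n=1] rack_word_simps whisker_Ident Ident_elt ac_simps eqs)
qed

lemma act'_act:
  assumes x: "x \<in> elt (a + 2 + b)"
  shows "whisker a act' b \<cdot> whisker a act (b + 1) \<cdot> whisker (a + 1) c b \<cdot> whisker (a + 1) \<Delta> b \<cdot> x
    = whisker (a + 1) \<epsilon> b \<cdot> x"
proof -
  have "whisker 0 act' 0 \<cdot> whisker 0 act 1 \<cdot> whisker 1 c 0 \<cdot> whisker 1 \<Delta> 0 = whisker 1 \<epsilon> 0"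
    using rack I_tensor[OF \<epsilon>_in_mor, of 1] by (simp add: rack_def leg_eq_whisker whisker_0_0[OF act'_in_mor] T_1)
  from arg_cong[OF this, of "\<lambda>f. whisker a f b \<cdot> x"] x show ?thesis
    by (simp add: rack_word_Comp[where n=2] rack_word_simps ac_simps)
qed

lemma act_act':
  assumes x: "x \<in> elt (a + 2 + b)"
  shows "whisker a act b \<cdot> whisker a act' (b + 1) \<cdot> whisker (a + 1) c b \<cdot> whisker (a + 1) \<Delta> b \<cdot> x
    = whisker (a + 1) \<epsilon> b \<cdot> x"
proof -
  have "whisker 0 act 0 \<cdot> whisker 0 act' 1 \<cdot> whisker 1 c 0 \<cdot> whisker 1 \<Delta> 0 = whisker 1 \<epsilon> 0"
    using rack I_tensor[OF \<epsilon>_in_mor, of 1] by (simp add: rack_def leg_eq_whisker whisker_0_0[OF act_in_mor] T_1)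
  from arg_cong[OF this, of "\<lambda>f. whisker a f b \<cdot> x"] x show ?thesis
    by (simp add: rack_word_Comp[where n=2] rack_word_simps ac_simps)
qed

lemmas rack_elt_simps = elt_simps whisker_in_elt[OF act'_in_mor] whisker_in_elt[OF \<epsilon>_in_mor]

text \<open>The cancellation laws \<open>act'_act\<close> and \<open>act_act'\<close> are left out;
  each is applied separately once its pattern has been exposed.\<close>

lemmas rack_normalize = normalize
  whisker_swap_left[OF c_in_mor act'_in_mor] whisker_swap_right[OF c_in_mor act'_in_mor]
  whisker_swap_left[OF \<Delta>_in_mor act'_in_mor] whisker_swap_right[OF \<Delta>_in_mor act'_in_mor]
  c_natural_2_1_left[OF act'_in_mor] c_natural_2_1_right[OF act'_in_mor]
  c_natural_1_0_left[OF \<epsilon>_in_mor] c_natural_1_0_right[OF \<epsilon>_in_mor] counit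

abbreviation \<tau> where
  "\<tau> \<equiv> leg C V 1 1 act' \<cdot> leg C V 1 2 c \<cdot> leg C V 1 1 c \<cdot> leg C V 1 2 c \<cdot> leg C V 1 1 \<Delta>"

lemma \<tau>_eq:
  "\<tau> = whisker 0 act' 1 \<cdot> whisker 1 c 0 \<cdot> whisker 0 c 1 \<cdot> whisker 1 c 0 \<cdot> whisker 0 \<Delta> 1"
  by (simp add: leg_eq_whisker)

lemma \<tau>_in_mor: "\<tau> \<in> mor 2 2"
  unfolding \<tau>_eq by (simp add: rack_word_simps)

lemma \<sigma>_Comp:
  assumes "x \<in> elt 2"
  shows "\<sigma> \<cdot> x = whisker 1 act 0 \<cdot> whisker 0 c 1 \<cdot> whisker 1 \<Delta> 0 \<cdot> x"
  using whisker_\<sigma>[of x 0 0] assms by (simp add: whisker_0_0[OF \<sigma>_in_mor])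

lemma \<tau>_Comp:
  assumes "x \<in> elt 2"
  shows "\<tau> \<cdot> x = whisker 0 act' 1 \<cdot> whisker 1 c 0 \<cdot> whisker 0 c 1 \<cdot> whisker 1 c 0 \<cdot> whisker 0 \<Delta> 1 \<cdot> x"
proof -
  \<comment> \<open>Whiskering by no strands makes the peeling rules available for reassociating the
    composite.\<close>
  have "whisker 0 \<tau> 0 \<cdot> x = whisker 0 act' 1 \<cdot> whisker 1 c 0 \<cdot> whisker 0 c 1 \<cdot> whisker 1 c 0 \<cdot> whisker 0 \<Delta> 1 \<cdot> x"
    using assms unfolding \<tau>_eq by (simp add: rack_word_Comp[where n=2] rack_word_simps)
  then show ?thesis
    by (simp add: whisker_0_0[OF \<tau>_in_mor])
qed

lemma \<tau>_\<sigma>: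
  assumes x: "x \<in> elt 2"
  shows "\<tau> \<cdot> \<sigma> \<cdot> x = x"
proof -
  \<comment> \<open>This is ((a \<lhd> b3) \<lhd>~ b2, b1). The right-hand side is not normal: it
    keeps the second splitting of b late, so that the pattern of \<open>act'_act\<close> shows on
    the first two strands.\<close>
  have "\<tau> \<cdot> \<sigma> \<cdot> x = whisker 0 act' 1 \<cdot> whisker 0 act 2 \<cdot> whisker 1 c 1 \<cdot> whisker 1 \<Delta> 1 \<cdot>
      whisker 1 c 0 \<cdot> whisker 1 \<Delta> 0 \<cdot> x"
    by (simp add: \<sigma>_Comp \<tau>_Comp[unfolded \<tau>_eq] \<tau>_eq rack_normalize x rack_elt_simps)
  also have "\<dots> = whisker 1 \<epsilon> 1 \<cdot> whisker 1 c 0 \<cdot> whisker 1 \<Delta> 0 \<cdot> x"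
    using act'_act[of "whisker 1 c 0 \<cdot> whisker 1 \<Delta> 0 \<cdot> x" 0 1] by (simp add: x elt_simps)
  also have "\<dots> = x"
    by (simp add: rack_normalize x rack_elt_simps)
  finally show ?thesis .
qed

lemma \<sigma>_\<tau>:
  assumes x: "x \<in> elt 2"
  shows "\<sigma> \<cdot> \<tau> \<cdot> x = x"
proof -
  \<comment> \<open>This is (a1, (b \<lhd>~ a3) \<lhd> a2), arranged likewise so that
    \<open>act_act'\<close> applies beside the untouched strand a1.\<close>
  have "\<sigma> \<cdot> \<tau> \<cdot> x = whisker 1 act 0 \<cdot> whisker 1 act' 1 \<cdot> whisker 2 c 0 \<cdot> whisker 2 \<Delta> 0 \<cdot>
      whisker 1 c 0 \<cdot> whisker 0 \<Delta> 1 \<cdot> x"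
    by (simp add: \<sigma>_Comp \<tau>_Comp[unfolded \<tau>_eq] \<tau>_eq rack_normalize x rack_elt_simps)
  also have "\<dots> = whisker 2 \<epsilon> 0 \<cdot> whisker 1 c 0 \<cdot> whisker 0 \<Delta> 1 \<cdot> x"
    using act_act'[of "whisker 1 c 0 \<cdot> whisker 0 \<Delta> 1 \<cdot> x" 1 0] by (simp add: x elt_simps)
  also have "\<dots> = x"
    by (simp add: rack_normalize x rack_elt_simps)
  finally show ?thesis .
qed

lemma inverse_arrows_\<sigma>_\<tau>: "inverse_arrows C \<sigma> \<tau>"
proof -
  have \<sigma>: "\<sigma> \<in> Arr C" "Dom C \<sigma> = T 2" "Cod C \<sigma> = T 2"
    using \<sigma>_in_mor by (simp_all add: hom_def)
  have "\<tau> \<cdot> \<sigma> = I 2"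
    using \<tau>_\<sigma>[OF mor_elt[OF I_in_mor[of 2]]] by (simp add: Comp_Ident_right[OF \<sigma>_in_mor])
  moreover have "\<sigma> \<cdot> \<tau> = I 2"
    using \<sigma>_\<tau>[OF mor_elt[OF I_in_mor[of 2]]] by (simp only: Comp_Ident_right[OF \<tau>_in_mor])
  ultimately show ?thesis
    using \<tau>_in_mor by (simp add: inverse_arrows_def \<sigma>)
qed

end

theorem proposition4p10:
  fixes C :: "('o, 'm, 'z) symcat_scheme"
    and V :: 'o and \<Delta> act :: 'm
  assumes "symmetric_category C"
    and "shelf C V \<Delta> act"
  shows "weak_braiding C V (shelf_braiding C V \<Delta> act) \<and>
    (\<forall>\<epsilon> act'. rack C V \<Delta> act \<epsilon> act' \<longrightarrow>
       specific_braiding C V (shelf_braiding C V \<Delta> act) \<and>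
       inverse_arrows C (shelf_braiding C V \<Delta> act)
         (leg C V 1 1 act' \<cdot>\<^bsub>C\<^esub> leg C V 1 2 (Braid C V V) \<cdot>\<^bsub>C\<^esub> leg C V 1 1 (Braid C V V)
            \<cdot>\<^bsub>C\<^esub> leg C V 1 2 (Braid C V V) \<cdot>\<^bsub>C\<^esub> leg C V 1 1 \<Delta>))"
proof -
  interpret symmetric_category C by fact
  interpret shelf_object C V \<Delta> act
    using assms(2) by unfold_locales (simp_all add: shelf_def)
  have "specific_braiding C V (shelf_braiding C V \<Delta> act) \<and> inverse_arrows C (shelf_braiding C V \<Delta> act)
      (leg C V 1 1 act' \<cdot>\<^bsub>C\<^esub> leg C V 1 2 (Braid C V V) \<cdot>\<^bsub>C\<^esub> leg C V 1 1 (Braid C V V)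
            \<cdot>\<^bsub>C\<^esub> leg C V 1 2 (Braid C V V) \<cdot>\<^bsub>C\<^esub> leg C V 1 1 \<Delta>)" if "rack C V \<Delta> act \<epsilon> act'" for \<epsilon> act'
  proof -
    interpret rack_object C V \<Delta> act \<epsilon> act'
      using that by unfold_locales
    show ?thesis
      using weak_braiding_\<sigma> inverse_arrows_\<sigma>_\<tau> unfolding specific_braiding_def invertible_def by blast
  qed
  then show ?thesis
    using weak_braiding_\<sigma> by blast
qed

end
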